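(* Let $\mathcal{D}$ be an $n$-trace diagram in which every matrix marking is adjacent to an $n$-vertex, and let $N_{\mathcal{D}}$ be the compatible partition number of $\mathcal{D}$. Then (for any framing of $\mathcal{D}$) the trace diagram function $f_{\mathcal{D}}$ may be expressed as a summation over a product of $N_{\mathcal{D}}$ matrix minors; that is, each coefficient of $f_{\mathcal{D}}$ in the standard bases is a finite sum, with coefficients not depending on the matrix entries, of products of $N_{\mathcal{D}}$ minors of the matrices labeling $\mathcal{D}$.
   Context: Let $\mathbb{F}$ be a field, $n\ge 2$, $N=\{1,\dots,n\}$, and let $V$ be an $n$-dimensional $\mathbb{F}$-vector space with basis $\hat e_1,\dots,\hat e_n$, orthonormal for the bilinear form $\langle \hat e_i,\hat e_j\rangle=\delta_{ij}$. A linear map $A:V\to V$ has matrix entries $(A)_{ij}=\langle \hat e_i,A\hat e_j\rangle$. For $\alpha\in N^k$ put $\hat e_\alpha=\hat e_{\alpha_1}\otimes\cdots\otimes\hat e_{\alpha_k}$; $V^{\otimes 0}=\mathbb{F}$. Graphs are finite; edges may be repeated, and an edge joins two vertices, or is a loop at one vertex (counted twice in the degree), or is a trivial loop $\bigcirc$ meeting no vertex. An $n$-trace diagram $\mathcal{D}$ is a graph whose vertex set is a disjoint union $V_1\sqcup V_2\sqcup V_n$, vertices of $V_i$ having degree $i$ (if $n=2$, $V_2$ and $V_n$ are still kept disjoint), with an ordering $\sigma_v(1),\dots,\sigma_v(\deg v)$ of the edges at each vertex $v$ (a loop is listed twice), and a labeling of each $v\in V_2$ by a linear map $A_{\mathcal{D}}(v):V\to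 V$. For $v\in V_2$, $\sigma_v(1)$ is the incoming and $\sigma_v(2)$ the outgoing edge. Vertices in $V_n$ are called $n$-vertices, and labeled vertices in $V_2$ are called matrix markings; a matrix marking is adjacent to an $n$-vertex if an edge joins them. A framing is a partition of $V_1$ into an ordered list of inputs $V_I$ and an ordered list of outputs $V_O$. A coloring is a map $\kappa:E\to N$ on the edge set; it is proper if at each $v\in V_n$ the labels $\kappa(\sigma_v(1)),\dots,\kappa(\sigma_v(n))$ are distinct. For a proper coloring, $\mathrm{sgn}_\kappa(\mathcal{D})=\prod_{v\in V_n}\mathrm{sgn}(i\mapsto\kappa(\sigma_v(i)))$ and $\psi_\kappa(\mathcal{D})=\prod_{v\in V_2}(A_{\mathcal{D}}(v))_{\kappa(\sigma_v(2)),\,\kappa(\sigma_v(1))}$ (empty products are $1$). For a leaf-coloring $\gamma$ (a labeling by $N$ of the edges adjacent to degree-1 vertices), the weight is $\chi_\gamma(\mathcal{D})=\sum_{\kappa}\mathrm{sgn}_\kappa(\mathcal{D})\psi_\kappa(\mathcal{D})$, summed over proper colorings $\kappa$ extending $\gamma$. The trace diagram function of a framed diagram is the linear map $f_{\mathcal{D}}:V^{\otimes |V_I|}\to V^{\otimes|V_O|}$, $\hat e_\alpha\mapsto\sum_{\beta\in N^{|V_O|}}\chi_{\alpha\cup\beta}(\mathcal{D})\,\hat e_\beta$, where $\alpha\cup\beta$ labels the edge at the $j$-th input by $\alpha_j$ and the edge at the $j$-th output by $\beta_j$; the weight is $0$ if these labels conflict. A collection of matrix markings is a compatible matrix collection if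 (i) they have the same matrix label, (ii) they are adjacent to the same $n$-vertex, and (iii) they have the same orientation relative to that $n$-vertex (all oriented towards it or all oriented away from it). For a trace diagram in which every matrix marking is adjacent to an $n$-vertex, the compatible partition number $N_{\mathcal{D}}$ is the minimum number of collections in a partition of all matrix markings of $\mathcal{D}$ into compatible matrix collections. A minor $[A_{I,J}]$ of an $n\times n$ matrix $A$ is the determinant of the submatrix with rows $I$ and columns $J$, where $I,J\subset N$ are increasingly ordered subsets of the same size. *)

theory Defs
  imports
    "HOL-Library.Multiset"
    "HOL-Library.FuncSet"
    "HOL-Library.Disjoint_Sets"
    "HOL-Combinatorics.Permutations"
    "Jordan_Normal_Form.Determinant"
    "Jordan_Normal_Form.DL_Submatrix"
begin

text \<open>
  Indices are shifted down by one: N is \<open>{..<n}\<close>, so that matrices, submatrices and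
  signs of permutations of N are the library's.
\<close>

section \<open>Trace diagrams\<close>

text \<open>
  \<open>edge_ends D e\<close> is the multiset of end points of \<open>e\<close>: \<open>{#u, v#}\<close> with \<open>u \<noteq> v\<close> for an
  ordinary edge, \<open>{#v, v#}\<close> for a loop, and \<open>{#}\<close> for a trivial loop, which meets no vertex.
  Distinct elements of \<open>edge_set D\<close> may have the same end points.
  \<open>edge_order D v\<close> is the list \<open>\<sigma>\<^sub>v(1), \<dots>, \<sigma>\<^sub>v(deg v)\<close>.
\<close>

record ('x, 'e, 'l) diagram =
  leaves :: "'x set"
  markings :: "'x set"
  nvertices :: "'x set"
  edge_set :: "'e set"
  edge_ends :: "'e \<Rightarrow> 'x multiset"
  edge_order :: "'x \<Rightarrow> 'e list"
  marking_label :: "'x \<Rightarrow> 'l"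

definition vertices :: "('x, 'e, 'l) diagram \<Rightarrow> 'x set" where
  "vertices D = leaves D \<union> markings D \<union> nvertices D"

definition vertex_degree :: "('x, 'e, 'l) diagram \<Rightarrow> 'x \<Rightarrow> nat" where
  "vertex_degree D v = (\<Sum>e\<in>edge_set D. count (edge_ends D e) v)"

definition trace_diagram :: "nat \<Rightarrow> ('x, 'e, 'l) diagram \<Rightarrow> bool" where
  "trace_diagram n D \<longleftrightarrow>
     finite (vertices D) \<and> finite (edge_set D) \<and>
     leaves D \<inter> markings D = {} \<and> leaves D \<inter> nvertices D = {} \<and>
     markings D \<inter> nvertices D = {} \<and>
     (\<forall>e\<in>edge_set D. edge_ends D e = {#} \<or>
        (\<exists>u\<in>vertices D. \<exists>v\<in>vertices D. edge_ends D e = {#u, v#})) \<and>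
     (\<forall>v\<in>leaves D. vertex_degree D v = 1) \<and>
     (\<forall>v\<in>markings D. vertex_degree D v = 2) \<and>
     (\<forall>v\<in>nvertices D. vertex_degree D v = n) \<and>
     (\<forall>v\<in>vertices D. \<forall>e. count (mset (edge_order D v)) e =
        (if e \<in> edge_set D then count (edge_ends D e) v else 0))"

definition in_edge :: "('x, 'e, 'l) diagram \<Rightarrow> 'x \<Rightarrow> 'e" where
  "in_edge D v = edge_order D v ! 0"

definition out_edge :: "('x, 'e, 'l) diagram \<Rightarrow> 'x \<Rightarrow> 'e" where
  "out_edge D v = edge_order D v ! 1"

definition leaf_edge :: "('x, 'e, 'l) diagram \<Rightarrow> 'x \<Rightarrow> 'e" where
  "leaf_edge D v = edge_order D v ! 0"

definition framing :: "('x, 'e, 'l) diagram \<Rightarrow> 'x list \<Rightarrow> 'x list \<Rightarrow> bool" where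
  "framing D ins outs \<longleftrightarrow> distinct (ins @ outs) \<and> set (ins @ outs) = leaves D"

section \<open>Colorings\<close>

definition colorings :: "nat \<Rightarrow> ('x, 'e, 'l) diagram \<Rightarrow> ('e \<Rightarrow> nat) set" where
  "colorings n D = edge_set D \<rightarrow>\<^sub>E {..<n}"

definition proper :: "('x, 'e, 'l) diagram \<Rightarrow> ('e \<Rightarrow> nat) \<Rightarrow> bool" where
  "proper D \<kappa> \<longleftrightarrow> (\<forall>v\<in>nvertices D. distinct (map \<kappa> (edge_order D v)))"

definition coloring_sign :: "nat \<Rightarrow> ('x, 'e, 'l) diagram \<Rightarrow> ('e \<Rightarrow> nat) \<Rightarrow> int" where
  "coloring_sign n D \<kappa> =
     (\<Prod>v\<in>nvertices D. sign (\<lambda>i. if i < n then \<kappa> (edge_order D v ! i) else i))"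

text \<open>
  A leaf-coloring is given by its graph, a set of pairs of an edge and a color. If it gives
  two colors to one edge (as \<open>\<alpha> \<union> \<beta>\<close> can when an edge joins two leaves), no coloring extends
  it, and the weight below is an empty sum.
\<close>

definition extends :: "('e \<Rightarrow> nat) \<Rightarrow> ('e \<times> nat) set \<Rightarrow> bool" where
  "extends \<kappa> \<gamma> \<longleftrightarrow> (\<forall>(e, c)\<in>\<gamma>. \<kappa> e = c)"

definition leaf_coloring ::
  "('x, 'e, 'l) diagram \<Rightarrow> 'x list \<Rightarrow> nat list \<Rightarrow> ('e \<times> nat) set" where
  "leaf_coloring D vs \<alpha> = set (zip (map (leaf_edge D) vs) \<alpha>)"

definition multi_indices :: "nat \<Rightarrow> nat \<Rightarrow> nat list set" where
  "multi_indices n k = {\<alpha>. length \<alpha> = k \<and> set \<alpha> \<subseteq> {..<n}}"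

section \<open>Weights and the trace diagram function\<close>

locale orthonormal_basis = Vector_Spaces.vector_space scale
  for scale :: "'a::field \<Rightarrow> 'b::ab_group_add \<Rightarrow> 'b" +
  fixes n :: nat and e :: "nat \<Rightarrow> 'b" and form :: "'b \<Rightarrow> 'b \<Rightarrow> 'a"
  assumes basis_inj: "inj_on e {..<n}"
    and basis_independent: "independent (e ` {..<n})"
    and basis_span: "span (e ` {..<n}) = UNIV"
    and form_linear_left: "Vector_Spaces.linear scale (*) (\<lambda>x. form x y)"
    and form_linear_right: "Vector_Spaces.linear scale (*) (\<lambda>y. form x y)"
    and orthonormal: "i < n \<Longrightarrow> j < n \<Longrightarrow> form (e i) (e j) = (if i = j then 1 else 0)"
begin

definition matrix_of :: "('b \<Rightarrow> 'b) \<Rightarrow> 'a mat" where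
  "matrix_of A = mat n n (\<lambda>(i, j). form (e i) (A (e j)))"

definition minor :: "('b \<Rightarrow> 'b) \<Rightarrow> nat set \<Rightarrow> nat set \<Rightarrow> 'a" where
  "minor A I J = det (submatrix (matrix_of A) I J)"

definition marking_product :: "('x, 'e, 'b \<Rightarrow> 'b) diagram \<Rightarrow> ('e \<Rightarrow> nat) \<Rightarrow> 'a" where
  "marking_product D \<kappa> =
     (\<Prod>v\<in>markings D.
        matrix_of (marking_label D v) $$ (\<kappa> (out_edge D v), \<kappa> (in_edge D v)))"

definition weight :: "('x, 'e, 'b \<Rightarrow> 'b) diagram \<Rightarrow> ('e \<times> nat) set \<Rightarrow> 'a" where
  "weight D \<gamma> =
     (\<Sum>\<kappa>\<in>{\<kappa> \<in> colorings n D. proper D \<kappa> \<and> extends \<kappa> \<gamma>}.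
        of_int (coloring_sign n D \<kappa>) * marking_product D \<kappa>)"

text \<open>
  An element of the \<open>k\<close>-th tensor power of V is represented by its coordinates: a function on
  multi-indices that vanishes outside \<open>multi_indices n k\<close>. \<open>tensor vs\<close> is the pure tensor of the
  vectors \<open>vs\<close>.
\<close>

definition tensor :: "'b list \<Rightarrow> nat list \<Rightarrow> 'a" where
  "tensor vs = (\<lambda>\<alpha>. if \<alpha> \<in> multi_indices n (length vs)
     then \<Prod>j<length vs. form (e (\<alpha> ! j)) (vs ! j) else 0)"

definition basis_tensor :: "nat list \<Rightarrow> nat list \<Rightarrow> 'a" where
  "basis_tensor \<alpha> = tensor (map e \<alpha>)"

definition trace_diagram_function ::
  "('x, 'e, 'b \<Rightarrow> 'b) diagram \<Rightarrow> 'x list \<Rightarrow> 'x list \<Rightarrow>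
     (nat list \<Rightarrow> 'a) \<Rightarrow> (nat list \<Rightarrow> 'a)" where
  "trace_diagram_function D ins outs x = (\<lambda>\<delta>.
     \<Sum>\<alpha>\<in>multi_indices n (length ins). x \<alpha> *
       (\<Sum>\<beta>\<in>multi_indices n (length outs).
          weight D (leaf_coloring D ins \<alpha> \<union> leaf_coloring D outs \<beta>) * basis_tensor \<beta> \<delta>))"

lemma basis_tensor_apply:
  assumes "\<alpha> \<in> multi_indices n k"
  shows "basis_tensor \<alpha> \<beta> = (if \<beta> = \<alpha> then 1 else 0)"
proof (cases "\<beta> \<in> multi_indices n k")
  case True
  have eq: "basis_tensor \<alpha> \<beta> = (\<Prod>j<k. if \<beta> ! j = \<alpha> ! j then 1 else 0)"
    using assms True unfolding basis_tensor_def tensor_def multi_indices_def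
    by (auto intro!: prod.cong orthonormal simp: subset_iff)
  show ?thesis
  proof (cases "\<beta> = \<alpha>")
    case False
    then obtain j where "j < k" "\<beta> ! j \<noteq> \<alpha> ! j"
      using assms True unfolding multi_indices_def by (auto simp: list_eq_iff_nth_eq)
    then show ?thesis unfolding eq using False by (auto intro!: prod_zero)
  next
    case True
    then show ?thesis using eq by simp
  qed
next
  case False
  then show ?thesis
    using assms unfolding basis_tensor_def tensor_def multi_indices_def by auto
qed

lemma finite_multi_indices: "finite (multi_indices n k)"
  unfolding multi_indices_def
  using finite_lists_length_eq[of "{..<n}" k] by (simp add: conj_commute)

lemma trace_diagram_function_basis_tensor:
  assumes "\<alpha> \<in> multi_indices n (length ins)"
  shows "trace_diagram_function D ins outs (basis_tensor \<alpha>) =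
    (\<lambda>\<delta>. \<Sum>\<beta>\<in>multi_indices n (length outs).
       weight D (leaf_coloring D ins \<alpha> \<union> leaf_coloring D outs \<beta>) * basis_tensor \<beta> \<delta>)"
  unfolding trace_diagram_function_def basis_tensor_apply[OF assms]
  using assms by (simp add: finite_multi_indices if_distrib[where f = "\<lambda>x. x * _"] sum.delta cong: if_cong)

end

section \<open>Compatible matrix collections\<close>

definition joins :: "('x, 'e, 'l) diagram \<Rightarrow> 'e \<Rightarrow> 'x \<Rightarrow> 'x \<Rightarrow> bool" where
  "joins D e u v \<longleftrightarrow> e \<in> edge_set D \<and> edge_ends D e = {#u, v#}"

definition adjacent :: "('x, 'e, 'l) diagram \<Rightarrow> 'x \<Rightarrow> 'x \<Rightarrow> bool" where
  "adjacent D u v \<longleftrightarrow> (\<exists>e. joins D e u v)"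

text \<open>
  A marking is oriented towards \<open>w\<close> if its outgoing edge joins it to \<open>w\<close>, and away from \<open>w\<close> if
  its incoming edge does. Both hold when both its edges join it to \<open>w\<close>.
\<close>

definition compatible_collection :: "('x, 'e, 'l) diagram \<Rightarrow> 'x set \<Rightarrow> bool" where
  "compatible_collection D C \<longleftrightarrow>
     C \<subseteq> markings D \<and>
     (\<forall>u\<in>C. \<forall>v\<in>C. marking_label D u = marking_label D v) \<and>
     (\<exists>w\<in>nvertices D. (\<forall>v\<in>C. adjacent D v w) \<and>
        ((\<forall>v\<in>C. joins D (out_edge D v) v w) \<or> (\<forall>v\<in>C. joins D (in_edge D v) v w)))"

definition compatible_partition_number :: "('x, 'e, 'l) diagram \<Rightarrow> nat" where
  "compatible_partition_number D =
     (LEAST k. \<exists>P. partition_on (markings D) P \<and> (\<forall>C\<in>P. compatible_collection D C) \<and>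
        card P = k)"

text \<open>
  \<open>relabel \<phi> D\<close> replaces every matrix label \<open>A\<close> by \<open>\<phi> A\<close>, so equal labels stay equal. An
  expression of the coefficients of D has coefficients not depending on the matrix entries iff it
  remains valid under every such substitution of the matrices.
\<close>

definition relabel :: "('l \<Rightarrow> 'm) \<Rightarrow> ('x, 'e, 'l) diagram \<Rightarrow> ('x, 'e, 'm) diagram" where
  "relabel \<phi> D =
     \<lparr>leaves = leaves D, markings = markings D, nvertices = nvertices D,
      edge_set = edge_set D, edge_ends = edge_ends D, edge_order = edge_order D,
      marking_label = \<lambda>v. \<phi> (marking_label D v)\<rparr>"

end

theory Submission
  imports Defs
begin

text \<open>
  Fix a partition of the markings into compatible collections. In a collection \<open>C\<close>, the edges
  joining its markings to their common n-vertex (the inner edges of \<open>C\<close>) meet nothing else, so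
  inner edges of distinct collections are distinct, and the second edge of a marking is never
  inner. Permuting the colors of the inner edges of \<open>C\<close> therefore keeps a coloring proper,
  multiplies its sign by that of the permutation, and affects only the matrix entries of \<open>C\<close>.
  Each orbit under these permutations has one coloring that is increasing on the inner edges of
  every collection, and the sum over the orbit is a product of determinants, one for each
  collection: up to sign a minor, or 0 if the other edges of the collection repeat a color.
\<close>

section \<open>Sums over orbits of permutations\<close>

text \<open>Take the inverse of \<open>g\<close> after \<open>f\<close> on \<open>A\<close> and the
  identity elsewhere. Applied to enumerations of one set, it yields the permutations whose signs are
  compared later.\<close>

lemma ex_permutes_bij_betw:
  assumes "bij_betw f A B" "bij_betw g A B"
  shows "\<exists>p. p permutes A \<and> (\<forall>x\<in>A. f x = g (p x))"
proof -
  define p where "p x = (if x \<in> A then inv_into A g (f x) else x)" for x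
  have "bij_betw (inv_into A g \<circ> f) A A"
    using assms by (intro bij_betw_trans bij_betw_inv_into)
  then have "bij_betw p A A"
    by (rule bij_betw_cong[THEN iffD1, rotated]) (simp add: p_def)
  then have "p permutes A"
    by (rule bij_imp_permutes) (simp add: p_def)
  moreover have "f x = g (p x)" if "x \<in> A" for x
    using that assms by (auto simp: p_def bij_betw_def f_inv_into_f)
  ultimately show ?thesis by blast
qed

text \<open>Injectivity on \<open>es\<close> makes the action by composition free, and every orbit
  contains exactly one coloring whose colors increase along \<open>es\<close>. Hence
  \<open>S\<close> is in bijection with pairs of a sorted representative and a permutation.\<close>

lemma sum_permute_sorted:
  fixes S :: "('e \<Rightarrow> 'c::linorder) set" and g :: "_ \<Rightarrow> 'a::comm_monoid_add"
  assumes "distinct es"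
    and closed: "\<And>\<kappa> \<pi>. \<kappa> \<in> S \<Longrightarrow> \<pi> permutes set es \<Longrightarrow> \<kappa> \<circ> \<pi> \<in> S"
    and inj: "\<And>\<kappa>. \<kappa> \<in> S \<Longrightarrow> inj_on \<kappa> (set es)"
  shows "(\<Sum>\<kappa>\<in>S. g \<kappa>) =
    (\<Sum>\<kappa>\<in>{\<kappa>\<in>S. sorted (map \<kappa> es)}. \<Sum>\<pi> | \<pi> permutes set es. g (\<kappa> \<circ> \<pi>))"
proof -
  let ?S' = "{\<kappa>\<in>S. sorted (map \<kappa> es)}" and ?P = "{\<pi>. \<pi> permutes set es}"
  have "bij_betw (\<lambda>(\<kappa>, \<pi>). \<kappa> \<circ> \<pi>) (?S' \<times> ?P) S"
  proof (rule bij_betwI')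
    fix x y assume x: "x \<in> ?S' \<times> ?P" and y: "y \<in> ?S' \<times> ?P"
    obtain \<kappa> \<pi> \<kappa>' \<pi>' where xy: "x = (\<kappa>, \<pi>)" "y = (\<kappa>', \<pi>')" by (metis surj_pair)
    have "x = y" if eq: "\<kappa> \<circ> \<pi> = \<kappa>' \<circ> \<pi>'"
    proof -
      have p: "\<pi> permutes set es" "\<pi>' permutes set es" and k: "\<kappa> \<in> S" "\<kappa>' \<in> S"
        and s: "sorted (map \<kappa> es)" "sorted (map \<kappa>' es)" using x y xy by auto
      \<comment> \<open>Both permutations preserve \<open>set es\<close>, so the two colorings use
        the same set of colors there. A sorted list without repetitions is determined by its
        set.\<close>
      have "\<kappa> ` set es = \<kappa>' ` set es"
        using arg_cong[OF eq, of "\<lambda>f. f ` set es"] p by (simp only: image_comp[symmetric] permutes_image)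
      then have "map \<kappa> es = map \<kappa>' es"
        using s inj[OF k(1)] inj[OF k(2)] \<open>distinct es\<close>
        by (intro sorted_distinct_set_unique) (auto simp: distinct_map)
      moreover have "\<kappa> z = \<kappa>' z" if "z \<notin> set es" for z
        using fun_cong[OF eq, of z] p that by (simp add: permutes_not_in)
      ultimately have kk: "\<kappa> = \<kappa>'" by (auto simp: fun_eq_iff)
      have "\<pi> z = \<pi>' z" for z
      proof (cases "z \<in> set es")
        case True
        then show ?thesis
          using fun_cong[OF eq, of z] kk inj[OF k(1)] p by (auto simp: inj_on_eq_iff permutes_in_image)
      qed (use p in \<open>auto simp: permutes_not_in\<close>)
      then show ?thesis using kk xy by auto
    qed
    then show "(case x of (\<kappa>, \<pi>) \<Rightarrow> \<kappa> \<circ> \<pi>) = (case y of (\<kappa>, \<pi>) \<Rightarrow> \<kappa> \<circ> \<pi>) \<longleftrightarrow> x = y"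
      using xy by auto
  next
    fix x assume "x \<in> ?S' \<times> ?P"
    then show "(case x of (\<kappa>, \<pi>) \<Rightarrow> \<kappa> \<circ> \<pi>) \<in> S" using closed by auto
  next
    fix \<kappa> assume k: "\<kappa> \<in> S"
    \<comment> \<open>For surjectivity, \<open>?L\<close> lists the colors of \<kappa> on
      \<open>es\<close> in the order that a representative must have.\<close>
    let ?L = "sorted_list_of_set (\<kappa> ` set es)" and ?I = "{..<length es}"
    have es: "bij_betw ((!) es) ?I (set es)"
      using \<open>distinct es\<close> by (intro bij_betw_nth) auto
    have len: "length ?L = length es"
      using inj[OF k] \<open>distinct es\<close> by (simp add: card_image distinct_card)
    have "bij_betw ((!) ?L) ?I (\<kappa> ` set es)"
      by (intro bij_betw_nth) (use len in auto)
    moreover have "bij_betw (\<kappa> \<circ> (!) es) ?I (\<kappa> ` set es)"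
      using es inj[OF k] by (rule bij_betw_trans[OF _ inj_on_imp_bij_betw])
    ultimately obtain p where p: "p permutes ?I" "\<And>i. i < length es \<Longrightarrow> ?L ! i = \<kappa> (es ! p i)"
      using ex_permutes_bij_betw[of "(!) ?L"] by fastforce
    \<comment> \<open>The permutation \<open>p\<close> acts on positions in \<open>es\<close>;
      transported to the edges it sorts \<kappa>, and its inverse leads from the representative back
      to \<kappa>.\<close>
    define \<pi> where "\<pi> = map_permutation ?I ((!) es) p"
    have \<pi>: "\<pi> permutes set es" unfolding \<pi>_def using es p(1) by (rule map_permutation_permutes)
    have "\<pi> (es ! i) = es ! p i" if "i < length es" for i
      unfolding \<pi>_def using es that by (simp add: map_permutation_apply bij_betw_def)
    then have "map (\<kappa> \<circ> \<pi>) es = ?L"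
      using len p(2) by (auto intro!: nth_equalityI)
    then have "sorted (map (\<kappa> \<circ> \<pi>) es)" by simp
    then have "(\<kappa> \<circ> \<pi>, Hilbert_Choice.inv \<pi>) \<in> ?S' \<times> ?P" using closed[OF k \<pi>] \<pi> by (auto simp: permutes_inv)
    moreover have "(\<kappa> \<circ> \<pi>) \<circ> Hilbert_Choice.inv \<pi> = \<kappa>" using \<pi> by (simp add: comp_assoc permutes_inv_o)
    ultimately show "\<exists>x\<in>?S' \<times> ?P. \<kappa> = (case x of (\<kappa>, \<pi>) \<Rightarrow> \<kappa> \<circ> \<pi>)" by force
  qed
  then have "(\<Sum>\<kappa>\<in>S. g \<kappa>) = (\<Sum>x\<in>?S' \<times> ?P. g (case x of (\<kappa>, \<pi>) \<Rightarrow> \<kappa> \<circ> \<pi>))"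
    by (rule sum.reindex_bij_betw[symmetric])
  then show ?thesis by (simp add: sum.cartesian_product split_def)
qed

text \<open>The sum of \<open>m\<close> over the orbit of \<kappa>, weighted by the sign that the
  coloring sign acquires. For products of matrix entries it becomes the Leibniz formula.\<close>

definition antisymmetrized ::
  "'e list \<Rightarrow> (('e \<Rightarrow> 'c) \<Rightarrow> 'a) \<Rightarrow> ('e \<Rightarrow> 'c) \<Rightarrow> 'a::comm_ring_1" where
  "antisymmetrized es m \<kappa> = (\<Sum>\<pi> | \<pi> permutes set es. of_int (sign \<pi>) * m (\<kappa> \<circ> \<pi>))"

lemma permutes_disjoint_commute:
  assumes "\<pi> permutes A" "\<rho> permutes B" "A \<inter> B = {}"
  shows "\<pi> \<circ> \<rho> = \<rho> \<circ> \<pi>"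
proof
  fix x
  show "(\<pi> \<circ> \<rho>) x = (\<rho> \<circ> \<pi>) x"
    using permutes_in_image[OF assms(1), of x] permutes_in_image[OF assms(2), of x]
      permutes_not_in[OF assms(1)] permutes_not_in[OF assms(2)] assms(3)
    by (cases "x \<in> A"; cases "x \<in> B") (auto simp: disjoint_iff)
qed

text \<open>Induction on \<open>P\<close>. The factor of the new collection is first absorbed into
  \<open>s\<close>, which keeps its sign rule for the remaining collections because their
  permutations leave that factor alone. After the induction hypothesis, the orbits of the new
  collection are summed.\<close>

lemma sum_prod_antisymmetrized:
  fixes S :: "('e \<Rightarrow> 'c::linorder) set" and s :: "_ \<Rightarrow> 'a::comm_ring_1"
  assumes "finite P"
    and "\<And>C. C \<in> P \<Longrightarrow> distinct (es C)"
    and "\<And>C C'. C \<in> P \<Longrightarrow> C' \<in> P \<Longrightarrow> C \<noteq> C' \<Longrightarrow> set (es C) \<inter> set (es C') = {}"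
    and "\<And>C \<kappa> \<pi>. C \<in> P \<Longrightarrow> \<kappa> \<in> S \<Longrightarrow> \<pi> permutes set (es C) \<Longrightarrow> \<kappa> \<circ> \<pi> \<in> S"
    and "\<And>C \<kappa>. C \<in> P \<Longrightarrow> \<kappa> \<in> S \<Longrightarrow> inj_on \<kappa> (set (es C))"
    and "\<And>C \<kappa> \<pi>. C \<in> P \<Longrightarrow> \<kappa> \<in> S \<Longrightarrow> \<pi> permutes set (es C) \<Longrightarrow>
      s (\<kappa> \<circ> \<pi>) = of_int (sign \<pi>) * s \<kappa>"
    and "\<And>C C' \<kappa> \<pi>. C \<in> P \<Longrightarrow> C' \<in> P \<Longrightarrow> C \<noteq> C' \<Longrightarrow> \<pi> permutes set (es C) \<Longrightarrow>
      m C' (\<kappa> \<circ> \<pi>) = m C' \<kappa>"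
  shows "(\<Sum>\<kappa>\<in>S. s \<kappa> * (\<Prod>C\<in>P. m C \<kappa>)) =
    (\<Sum>\<kappa>\<in>{\<kappa>\<in>S. \<forall>C\<in>P. sorted (map \<kappa> (es C))}.
       s \<kappa> * (\<Prod>C\<in>P. antisymmetrized (es C) (m C) \<kappa>))"
  using assms
proof (induction P arbitrary: s rule: finite_induct)
  case empty
  then show ?case by simp
next
  case (insert C P)
  note dist = insert.prems(1) and disj = insert.prems(2) and closed = insert.prems(3)
    and inj = insert.prems(4) and sgn = insert.prems(5) and indep = insert.prems(6)
  let ?S' = "{\<kappa>\<in>S. \<forall>C\<in>P. sorted (map \<kappa> (es C))}"
  let ?Q = "\<lambda>\<kappa>. \<Prod>C\<in>P. antisymmetrized (es C) (m C) \<kappa>"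
  have ne: "C' \<noteq> C" if "C' \<in> P" for C' using insert that by auto
  have fixes_C: "map (\<kappa> \<circ> \<pi>) (es C') = map \<kappa> (es C')"
    if "C' \<in> P" "\<pi> permutes set (es C)" for C' \<pi> and \<kappa> :: "'e \<Rightarrow> 'c"
    using disj[of C' C] ne[OF that(1)] that by (auto simp: permutes_not_in disjoint_iff)
  have anti_C: "antisymmetrized (es C') (m C') (\<kappa> \<circ> \<pi>) = antisymmetrized (es C') (m C') \<kappa>"
    if C': "C' \<in> P" and \<pi>: "\<pi> permutes set (es C)" for C' \<kappa> \<pi>
    unfolding antisymmetrized_def
  proof (intro sum.cong refl arg_cong2[where f = "(*)"])
    fix \<rho> assume "\<rho> \<in> {\<rho>. \<rho> permutes set (es C')}"
    then have "\<pi> \<circ> \<rho> = \<rho> \<circ> \<pi>"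
      using permutes_disjoint_commute[OF \<pi>, of \<rho> "set (es C')"] disj[of C C'] ne[OF C'] C' by auto
    \<comment> \<open>Permutations with disjoint supports commute, which moves \<pi> to the place
      where \<open>m C'\<close> is insensitive to it.\<close>
    then have eq: "(\<kappa> \<circ> \<pi>) \<circ> \<rho> = (\<kappa> \<circ> \<rho>) \<circ> \<pi>" by (simp only: comp_assoc)
    show "m C' ((\<kappa> \<circ> \<pi>) \<circ> \<rho>) = m C' (\<kappa> \<circ> \<rho>)"
      unfolding eq using C' ne[OF C'] \<pi> by (intro indep) auto
  qed
  have "(\<Sum>\<kappa>\<in>S. s \<kappa> * (\<Prod>C\<in>insert C P. m C \<kappa>)) = (\<Sum>\<kappa>\<in>S. (s \<kappa> * m C \<kappa>) * (\<Prod>C\<in>P. m C \<kappa>))"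
    using insert.hyps by (simp add: mult_ac)
  also have "\<dots> = (\<Sum>\<kappa>\<in>?S'. (s \<kappa> * m C \<kappa>) * ?Q \<kappa>)"
  proof (rule insert.IH)
    fix C' \<kappa> \<pi> assume *: "C' \<in> P" "\<kappa> \<in> S" "\<pi> permutes set (es C')"
    have s: "s (\<kappa> \<circ> \<pi>) = of_int (sign \<pi>) * s \<kappa>"
      by (rule sgn[OF insertI2]) (fact *)+
    have m: "m C (\<kappa> \<circ> \<pi>) = m C \<kappa>"
      by (rule indep[OF insertI2 insertI1]) (fact * ne[OF *(1)])+
    show "s (\<kappa> \<circ> \<pi>) * m C (\<kappa> \<circ> \<pi>) = of_int (sign \<pi>) * (s \<kappa> * m C \<kappa>)"
      unfolding s m by (rule mult.assoc)
  qed (rule dist disj closed inj indep; simp)+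
  \<comment> \<open>The set \<open>?S'\<close> is still closed under the permutations of
    \<open>es C\<close>, as these fix all edges on which sortedness is already imposed.\<close>
  also have "\<dots> = (\<Sum>\<kappa>\<in>{\<kappa>\<in>?S'. sorted (map \<kappa> (es C))}. \<Sum>\<pi> | \<pi> permutes set (es C).
      (s (\<kappa> \<circ> \<pi>) * m C (\<kappa> \<circ> \<pi>)) * ?Q (\<kappa> \<circ> \<pi>))"
  proof (rule sum_permute_sorted)
    show "distinct (es C)" by (rule dist) simp
    show "inj_on \<kappa> (set (es C))" if "\<kappa> \<in> ?S'" for \<kappa> using that by (intro inj) auto
    show "\<kappa> \<circ> \<pi> \<in> ?S'" if "\<kappa> \<in> ?S'" "\<pi> permutes set (es C)" for \<kappa> \<pi>
    proof -
      have "\<kappa> \<circ> \<pi> \<in> S" by (rule closed[OF insertI1]) (use that in auto)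
      moreover have "\<forall>C\<in>P. sorted (map (\<kappa> \<circ> \<pi>) (es C))"
        using that(1) by (simp only: fixes_C[OF _ that(2)] mem_Collect_eq cong: ball_cong) simp
      ultimately show ?thesis by blast
    qed
  qed
  also have "\<dots> = (\<Sum>\<kappa>\<in>{\<kappa>\<in>S. \<forall>C\<in>insert C P. sorted (map \<kappa> (es C))}.
      s \<kappa> * (\<Prod>C\<in>insert C P. antisymmetrized (es C) (m C) \<kappa>))"
  proof (rule sum.cong)
    fix \<kappa> assume "\<kappa> \<in> {\<kappa>\<in>S. \<forall>C\<in>insert C P. sorted (map \<kappa> (es C))}"
    then have k: "\<kappa> \<in> S" by auto
    have "(\<Sum>\<pi> | \<pi> permutes set (es C). (s (\<kappa> \<circ> \<pi>) * m C (\<kappa> \<circ> \<pi>)) * ?Q (\<kappa> \<circ> \<pi>)) =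
      (s \<kappa> * ?Q \<kappa>) * antisymmetrized (es C) (m C) \<kappa>"
      unfolding antisymmetrized_def[of "es C" "m C"] sum_distrib_left
    proof (intro sum.cong refl)
      fix \<pi> assume "\<pi> \<in> {\<pi>. \<pi> permutes set (es C)}"
      then have \<pi>: "\<pi> permutes set (es C)" by simp
      have "?Q (\<kappa> \<circ> \<pi>) = ?Q \<kappa>"
        by (intro prod.cong refl anti_C \<pi>)
      then show "(s (\<kappa> \<circ> \<pi>) * m C (\<kappa> \<circ> \<pi>)) * ?Q (\<kappa> \<circ> \<pi>) =
          (s \<kappa> * ?Q \<kappa>) * (of_int (sign \<pi>) * m C (\<kappa> \<circ> \<pi>))"
        unfolding sgn[OF insertI1 k \<pi>] by (simp only: mult_ac)
    qed
    then show "(\<Sum>\<pi> | \<pi> permutes set (es C). (s (\<kappa> \<circ> \<pi>) * m C (\<kappa> \<circ> \<pi>)) * ?Q (\<kappa> \<circ> \<pi>)) =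
        s \<kappa> * (\<Prod>C\<in>insert C P. antisymmetrized (es C) (m C) \<kappa>)"
      unfolding prod.insert[OF insert.hyps(1,2)] by (simp only: mult_ac)
  qed auto
  finally show ?case .
qed


section \<open>Determinants indexed by lists\<close>

text \<open>\<open>pick I\<close> is the increasing enumeration by which \<open>submatrix\<close>
  selects rows and columns. Monotonicity makes it injective, and counting makes it onto.\<close>

lemma bij_betw_pick:
  assumes "finite I"
  shows "bij_betw (pick I) {..<card I} I"
proof -
  have inj: "inj_on (pick I) {..<card I}"
    using pick_mono_le[of _ I] by (intro linorder_inj_onI) force+
  moreover have "pick I ` {..<card I} \<subseteq> I"
    using pick_in_set_le by auto
  moreover have "card (pick I ` {..<card I}) = card I"
    using inj by (simp add: card_image)
  ultimately show ?thesis
    using assms by (auto simp: bij_betw_def card_subset_eq)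
qed

lemma ex_permutes_nth_pick:
  assumes "distinct xs"
  shows "\<exists>p. p permutes {0..<length xs} \<and> (\<forall>i<length xs. xs ! i = pick (set xs) (p i))"
  using ex_permutes_bij_betw[OF bij_betw_nth[OF assms refl refl], of "pick (set xs)"]
    bij_betw_pick[of "set xs"] assms
  by (simp add: distinct_card atLeast0LessThan) blast

lemma det_permute_columns:
  fixes A :: "'a::comm_ring_1 mat"
  assumes A: "A \<in> carrier_mat n n" and p: "p permutes {0..<n}"
  shows "det (mat n n (\<lambda>(i, j). A $$ (i, p j))) = signof p * det A"
proof -
  let ?B = "mat n n (\<lambda>(i, j). A\<^sup>T $$ (p i, j))"
  have "mat n n (\<lambda>(i, j). A $$ (i, p j)) = ?B\<^sup>T"
    using A permutes_in_image[OF p] by (intro eq_matI) auto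
  moreover have "det ?B\<^sup>T = det ?B" by (rule det_transpose[of _ n]) simp
  moreover have "det ?B = signof p * det A"
    using det_permute_rows[OF transpose_carrier_mat[THEN iffD2, OF A] p] det_transpose[OF A] by simp
  ultimately show ?thesis by simp
qed

text \<open>If one of the lists repeats an index the determinant vanishes; the sign is then 0, and
  the minor is an arbitrary one of the right size.\<close>

lemma det_index_lists:
  assumes rs: "set rs \<subseteq> {..<n}" "length rs = k" and cs: "set cs \<subseteq> {..<n}" "length cs = k"
    and "distinct rs \<or> distinct cs"
  shows "\<exists>s I J. I \<subseteq> {..<n} \<and> J \<subseteq> {..<n} \<and> card I = k \<and> card J = k \<and>
    (\<forall>M::'a::comm_ring_1 mat. M \<in> carrier_mat n n \<longrightarrow>
       det (mat k k (\<lambda>(i, j). M $$ (rs ! i, cs ! j))) = of_int s * det (submatrix M I J))"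
proof (cases "distinct rs \<and> distinct cs")
  case True
  let ?I = "set rs" and ?J = "set cs"
  obtain p where p: "p permutes {0..<k}" "\<And>i. i < k \<Longrightarrow> rs ! i = pick ?I (p i)"
    using ex_permutes_nth_pick[of rs] True rs by auto
  obtain q where q: "q permutes {0..<k}" "\<And>i. i < k \<Longrightarrow> cs ! i = pick ?J (q i)"
    using ex_permutes_nth_pick[of cs] True cs by auto
  have card: "card ?I = k" "card ?J = k" using True rs cs by (auto simp: distinct_card)
  have "det (mat k k (\<lambda>(i, j). M $$ (rs ! i, cs ! j))) =
      of_int (sign p * sign q) * det (submatrix M ?I ?J)" if M: "M \<in> carrier_mat n n" for M :: "'a mat"
  proof -
    have sub: "{i. i < dim_row M \<and> i \<in> ?I} = ?I" "{j. j < dim_col M \<and> j \<in> ?J} = ?J"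
      using M rs cs by auto
    let ?S = "submatrix M ?I ?J"
    have S: "?S \<in> carrier_mat k k"
      by (intro carrier_matI) (simp_all only: dim_submatrix sub card)
    let ?B = "mat k k (\<lambda>(i, j). ?S $$ (i, q j))"
    have "mat k k (\<lambda>(i, j). M $$ (rs ! i, cs ! j)) = mat k k (\<lambda>(i, j). ?B $$ (p i, j))"
      using p q permutes_in_image[OF p(1)] permutes_in_image[OF q(1)]
      by (intro eq_matI) (auto simp: submatrix_index sub card)
    then show ?thesis
      using det_permute_rows[of ?B k p] det_permute_columns[OF S q(1)] p(1) by (simp add: mult_ac)
  qed
  then show ?thesis using rs cs card by blast
next
  case False
  obtain I where I: "I \<subseteq> {..<n}" "card I = k"
    using assms by (metis distinct_card)
  have "det (mat k k (\<lambda>(i, j). M $$ (rs ! i, cs ! j))) = 0" for M :: "'a mat"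
  proof (cases "distinct rs")
    case True
    then obtain a b where "a < k" "b < k" "a \<noteq> b" "cs ! a = cs ! b"
      using False cs by (auto simp: distinct_conv_nth)
    then show ?thesis by (intro det_identical_columns[of _ k a b]) auto
  next
    case False
    then obtain a b where "a < k" "b < k" "a \<noteq> b" "rs ! a = rs ! b"
      using rs by (auto simp: distinct_conv_nth)
    then show ?thesis by (intro det_identical_rows[of _ k a b]) auto
  qed
  then show ?thesis using I by (intro exI[of _ "0::int"] exI[of _ I]) auto
qed

text \<open>Conjugation by \<open>f\<close> is undone by conjugation by its inverse. This turns a
  sum over permutations of edges into one over permutations of positions.\<close>

lemma bij_betw_map_permutation:
  assumes "bij_betw f A B"
  shows "bij_betw (map_permutation A f) {p. p permutes A} {\<pi>. \<pi> permutes B}"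
proof (rule bij_betw_byWitness[where f' = "map_permutation B (inv_into A f)"])
  have inv: "bij_betw (inv_into A f) B A" using assms by (rule bij_betw_inv_into)
  show "\<forall>p\<in>{p. p permutes A}. map_permutation B (inv_into A f) (map_permutation A f p) = p"
    using map_permutation_compose_inv[OF assms] assms by (auto simp: bij_betw_def)
  show "\<forall>\<pi>\<in>{\<pi>. \<pi> permutes B}. map_permutation A f (map_permutation B (inv_into A f) \<pi>) = \<pi>"
    using map_permutation_compose_inv[OF inv] assms by (auto simp: bij_betw_def f_inv_into_f)
qed (use assms map_permutation_permutes bij_betw_inv_into in blast)+

text \<open>The Leibniz formula: a permutation of \<open>es\<close> moves the colors that index the
  columns, while the edges in \<open>os\<close> are fixed, being disjoint from \<open>es\<close>,
  and index the rows. A repeated entry of \<open>os\<close> makes two rows equal.\<close>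

lemma antisymmetrized_eq_det:
  fixes F :: "'c \<Rightarrow> 'c \<Rightarrow> 'a::comm_ring_1"
  assumes "distinct es" "length es = k" "length os = k" "set es \<inter> set os = {}"
  shows "antisymmetrized es (\<lambda>\<kappa>. \<Prod>i<k. F (\<kappa> (es ! i)) (\<kappa> (os ! i))) \<kappa> =
    det (mat k k (\<lambda>(i, j). F (\<kappa> (es ! j)) (\<kappa> (os ! i))))"
proof -
  let ?h = "map_permutation {0..<k} ((!) es)"
  have es: "bij_betw ((!) es) {0..<k} (set es)"
    using assms by (intro bij_betw_nth) auto
  have "antisymmetrized es (\<lambda>\<kappa>. \<Prod>i<k. F (\<kappa> (es ! i)) (\<kappa> (os ! i))) \<kappa> =
    (\<Sum>p | p permutes {0..<k}. of_int (sign (?h p)) *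
      (\<Prod>i<k. F ((\<kappa> \<circ> ?h p) (es ! i)) ((\<kappa> \<circ> ?h p) (os ! i))))"
    unfolding antisymmetrized_def
    by (rule sum.reindex_bij_betw[OF bij_betw_map_permutation[OF es], symmetric])
  also have "\<dots> = (\<Sum>p | p permutes {0..<k}. signof p *
      (\<Prod>i = 0..<k. mat k k (\<lambda>(i, j). F (\<kappa> (es ! j)) (\<kappa> (os ! i))) $$ (i, p i)))"
  proof (intro sum.cong refl arg_cong2[where f = "(*)"])
    fix p assume "p \<in> {p. p permutes {0..<k}}"
    then have p: "p permutes {0..<k}" by simp
    show "of_int (sign (?h p)) = signof p"
      using es p by (subst sign_map_permutation) (auto simp: bij_betw_def)
    have "?h p (es ! i) = es ! p i" "p i < k" if "i < k" for i
      using es that permutes_in_image[OF p, of i]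
      by (auto simp: map_permutation_apply bij_betw_def)
    moreover have "?h p (os ! i) = os ! i" if "i < k" for i
      using map_permutation_permutes[OF es p] assms that
      by (auto intro!: permutes_not_in[of _ "set es"] simp: disjoint_iff)
    ultimately show "(\<Prod>i<k. F ((\<kappa> \<circ> ?h p) (es ! i)) ((\<kappa> \<circ> ?h p) (os ! i))) =
      (\<Prod>i = 0..<k. mat k k (\<lambda>(i, j). F (\<kappa> (es ! j)) (\<kappa> (os ! i))) $$ (i, p i))"
      by (intro prod.cong) (auto simp: atLeast0LessThan)
  qed
  finally show ?thesis by (simp add: det_def'[of _ k])
qed

section \<open>Edges at the vertices of a trace diagram\<close>

lemma set_edge_order:
  assumes "trace_diagram n D" "v \<in> vertices D"
  shows "set (edge_order D v) = {e \<in> edge_set D. v \<in># edge_ends D e}"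
proof -
  have "e \<in> set (edge_order D v) \<longleftrightarrow> count (mset (edge_order D v)) e > 0" for e
    by (metis count_greater_zero_iff set_mset_mset)
  moreover have "count (mset (edge_order D v)) e = (if e \<in> edge_set D then count (edge_ends D e) v else 0)" for e
    using assms by (simp add: trace_diagram_def)
  ultimately show ?thesis by (auto split: if_splits)
qed

lemma length_edge_order:
  assumes "trace_diagram n D" "v \<in> vertices D"
  shows "length (edge_order D v) = vertex_degree D v"
proof -
  have fin: "finite (edge_set D)" using assms by (simp add: trace_diagram_def)
  have c: "count (mset (edge_order D v)) e = (if e \<in> edge_set D then count (edge_ends D e) v else 0)" for e
    using assms by (simp add: trace_diagram_def)
  have "length (edge_order D v) = (\<Sum>e\<in>set (edge_order D v). count (mset (edge_order D v)) e)"
    by (metis size_mset size_multiset_overloaded_eq set_mset_mset)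
  also have "\<dots> = (\<Sum>e\<in>edge_set D. count (mset (edge_order D v)) e)"
    by (intro sum.mono_neutral_left fin) (auto simp: set_edge_order[OF assms] count_eq_zero_iff)
  also have "\<dots> = vertex_degree D v" by (simp add: c vertex_degree_def)
  finally show ?thesis .
qed

lemma marking_edges:
  assumes "trace_diagram n D" "v \<in> markings D"
  shows "edge_order D v = [in_edge D v, out_edge D v]"
proof -
  have "length (edge_order D v) = 2"
    using length_edge_order[OF assms(1), of v] assms by (simp add: vertices_def trace_diagram_def)
  then show ?thesis
    by (auto simp: in_edge_def out_edge_def intro!: nth_equalityI simp: less_2_cases_iff)
qed

text \<open>An edge joining \<open>v\<close> to a different vertex has multiplicity one at
  \<open>v\<close>, so \<open>edge_order D v\<close> lists it only once.\<close>

lemma in_edge_neq_out_edge: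
  assumes D: "trace_diagram n D" "v \<in> markings D" "w \<in> nvertices D"
    and j: "joins D (in_edge D v) v w \<or> joins D (out_edge D v) v w"
  shows "in_edge D v \<noteq> out_edge D v"
proof
  assume eq: "in_edge D v = out_edge D v"
  have "v \<noteq> w" using D by (auto simp: trace_diagram_def)
  then have "count (mset (edge_order D v)) (in_edge D v) = 1"
    using D j eq by (auto simp: joins_def trace_diagram_def vertices_def)
  then show False using marking_edges[OF D(1,2)] eq by simp
qed

lemma leaf_edge_in_edge_order:
  assumes "trace_diagram n D" "v \<in> leaves D"
  shows "leaf_edge D v \<in> set (edge_order D v)"
proof -
  have "length (edge_order D v) = 1"
    using length_edge_order[OF assms(1), of v] assms by (simp add: vertices_def trace_diagram_def)
  then show ?thesis by (simp add: leaf_edge_def)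
qed

lemma joins_edge_order:
  assumes "trace_diagram n D" "joins D e v w" "u \<in> vertices D" "e \<in> set (edge_order D u)"
  shows "u = v \<or> u = w"
  using assms by (auto simp: set_edge_order joins_def)

lemma joins_in_edge_order:
  assumes "trace_diagram n D" "joins D e v w" "w \<in> vertices D"
  shows "e \<in> set (edge_order D w)"
  using assms by (auto simp: set_edge_order joins_def)

lemma adjacent_marking_cases:
  assumes "trace_diagram n D" "v \<in> markings D" "adjacent D v w"
  shows "joins D (out_edge D v) v w \<or> joins D (in_edge D v) v w"
proof -
  obtain e where e: "joins D e v w" using assms by (auto simp: adjacent_def)
  then have "e \<in> set (edge_order D v)"
    using assms by (auto simp: joins_def set_edge_order vertices_def)
  then show ?thesis using e marking_edges[OF assms(1,2)] by auto
qed

text \<open>The partition into singletons is compatible because each marking is adjacent to an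
  n-vertex. So the minimum ranges over a nonempty set and is attained.\<close>

lemma compatible_partition:
  assumes "trace_diagram n D" "\<forall>v\<in>markings D. \<exists>w\<in>nvertices D. adjacent D v w"
  obtains P where "partition_on (markings D) P" "\<And>C. C \<in> P \<Longrightarrow> compatible_collection D C"
    "card P = compatible_partition_number D"
proof -
  let ?P = "(\<lambda>v. {v}) ` markings D"
  have "partition_on (markings D) ?P"
    by (auto simp: partition_on_def disjoint_def)
  moreover have "\<forall>C\<in>?P. compatible_collection D C"
    using assms adjacent_marking_cases[OF assms(1)] by (fastforce simp: compatible_collection_def)
  ultimately have "\<exists>k P. partition_on (markings D) P \<and> (\<forall>C\<in>P. compatible_collection D C) \<and> card P = k"
    by blast
  from LeastI_ex[OF this] show ?thesis
    using that unfolding compatible_partition_number_def by blast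
qed


section \<open>Recoloring the edges of a compatible collection\<close>

text \<open>A partition into compatible collections with the choices made: a common n-vertex, one
  valid orientation, the common label and an enumeration. When both orientations are valid,
  \<open>towards\<close> decides which edges are inner.\<close>

locale oriented_partition =
  fixes n :: nat and D :: "('x, 'e, 'l) diagram" and P :: "'x set set"
    and hub :: "'x set \<Rightarrow> 'x" and towards :: "'x set \<Rightarrow> bool" and lab :: "'x set \<Rightarrow> 'l"
    and members :: "'x set \<Rightarrow> 'x list"
  assumes D: "trace_diagram n D"
    and P: "partition_on (markings D) P"
    and hub: "C \<in> P \<Longrightarrow> hub C \<in> nvertices D"
    and joins_hub: "C \<in> P \<Longrightarrow> v \<in> C \<Longrightarrow>
      joins D (if towards C then out_edge D v else in_edge D v) v (hub C)"
    and lab: "C \<in> P \<Longrightarrow> v \<in> C \<Longrightarrow> marking_label D v = lab C"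
    and members: "C \<in> P \<Longrightarrow> set (members C) = C" "C \<in> P \<Longrightarrow> distinct (members C)"
begin

definition inner :: "'x set \<Rightarrow> 'x \<Rightarrow> 'e" where
  "inner C v = (if towards C then out_edge D v else in_edge D v)"

text \<open>This edge may itself end at \<open>hub C\<close>, or be the outer edge of a second
  marking; it is never among the permuted edges.\<close>

definition outer :: "'x set \<Rightarrow> 'x \<Rightarrow> 'e" where
  "outer C v = (if towards C then in_edge D v else out_edge D v)"

text \<open>\<open>inners\<close> and \<open>outers\<close> both follow the order of
  \<open>members\<close>, so equal positions belong to the same marking.\<close>

definition inners :: "'x set \<Rightarrow> 'e list" where
  "inners C = map (inner C) (members C)"

definition outers :: "'x set \<Rightarrow> 'e list" where
  "outers C = map (outer C) (members C)"

section \<open>Incidence of inner and outer edges\<close>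

lemma finite_vertices: "finite (vertices D)" "finite (markings D)" "finite (nvertices D)"
  and finite_edge_set: "finite (edge_set D)"
  using D by (auto simp: trace_diagram_def vertices_def)

lemma vertex_kinds_disjoint:
  "u \<in> leaves D \<Longrightarrow> u \<notin> markings D" "u \<in> leaves D \<Longrightarrow> u \<notin> nvertices D"
  "u \<in> markings D \<Longrightarrow> u \<notin> nvertices D"
  using D by (auto simp: trace_diagram_def)

lemma collection_subset: "C \<in> P \<Longrightarrow> C \<subseteq> markings D"
  using P by (auto simp: partition_on_def)

lemma finite_collection: "C \<in> P \<Longrightarrow> finite C"
  using collection_subset finite_vertices finite_subset by blast

lemma collection_nonempty: "C \<in> P \<Longrightarrow> C \<noteq> {}"
  using P by (auto simp: partition_on_def)

lemma finite_P: "finite P"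
  using P finite_vertices by (metis finite_elements)

lemma collection_unique: "C \<in> P \<Longrightarrow> C' \<in> P \<Longrightarrow> v \<in> C \<Longrightarrow> v \<in> C' \<Longrightarrow> C = C'"
  using P by (auto simp: partition_on_def disjoint_def)

lemma length_members: "C \<in> P \<Longrightarrow> length (members C) = card C"
  using members by (metis distinct_card)

lemma set_inners: "C \<in> P \<Longrightarrow> set (inners C) = inner C ` C"
  by (simp add: inners_def members)

lemma set_outers: "C \<in> P \<Longrightarrow> set (outers C) = outer C ` C"
  by (simp add: outers_def members)

lemma inner_joins: "C \<in> P \<Longrightarrow> v \<in> C \<Longrightarrow> joins D (inner C v) v (hub C)"
  using joins_hub by (simp add: inner_def)

lemma inner_in_marking_order: "C \<in> P \<Longrightarrow> v \<in> C \<Longrightarrow> inner C v \<in> set (edge_order D v)"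
  and outer_in_marking_order: "C \<in> P \<Longrightarrow> v \<in> C \<Longrightarrow> outer C v \<in> set (edge_order D v)"
  using marking_edges[OF D, of v] collection_subset[of C]
  by (auto simp: inner_def outer_def subset_iff)

lemma inners_subset_edge_set: "C \<in> P \<Longrightarrow> set (inners C) \<subseteq> edge_set D"
  using inner_joins by (auto simp: set_inners joins_def)

lemma inners_subset_hub: "C \<in> P \<Longrightarrow> set (inners C) \<subseteq> set (edge_order D (hub C))"
  using inner_joins joins_in_edge_order[OF D] hub by (fastforce simp: set_inners vertices_def)

lemma inner_endpoint:
  assumes "C \<in> P" "v \<in> C" "u \<in> vertices D" "inner C v \<in> set (edge_order D u)"
  shows "u = v \<or> u = hub C"
  using joins_edge_order[OF D inner_joins] assms by blast

text \<open>The other end of an inner edge is an n-vertex, so an inner edge determines its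
  marking.\<close>

lemma marking_endpoint:
  assumes "C \<in> P" "v \<in> C" "u \<in> markings D" "inner C v \<in> set (edge_order D u)"
  shows "u = v"
  using inner_endpoint[of C v u] assms hub[of C] D by (auto simp: vertices_def trace_diagram_def)

text \<open>A common edge would meet both markings, so they would coincide by
  \<open>marking_endpoint\<close>; but the two edges of a single marking differ, as one of them
  leads to an n-vertex.\<close>

lemma inner_neq_outer:
  assumes "C \<in> P" "v \<in> C" "C' \<in> P" "u \<in> C'"
  shows "inner C v \<noteq> outer C' u"
proof
  assume eq: "inner C v = outer C' u"
  then have "u = v"
    using assms marking_endpoint outer_in_marking_order collection_subset by (metis subsetD)
  moreover from this have "C' = C" using assms collection_unique by blast
  ultimately show False
    using eq in_edge_neq_out_edge[OF D, of v "hub C"] inner_joins[of C v] hub[of C] assms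
      collection_subset[of C] by (auto simp: inner_def outer_def split: if_splits)
qed

lemma distinct_inners:
  assumes "C \<in> P" shows "distinct (inners C)"
proof -
  have "inj_on (inner C) C"
    using assms marking_endpoint inner_in_marking_order collection_subset
    by (intro inj_onI) (metis subsetD)
  then show ?thesis using assms by (simp add: inners_def distinct_map members)
qed

text \<open>This and the next two lemmas localize a recoloring: markings outside \<open>C\<close>,
  n-vertices other than the hub and leaves see none of the permuted edges.\<close>

lemma inners_disjoint_marking:
  assumes "C \<in> P" "u \<in> markings D" "u \<notin> C"
  shows "set (inners C) \<inter> set (edge_order D u) = {}"
  using assms marking_endpoint[of C _ u] by (auto simp: set_inners)

lemma inners_disjoint_nvertex:
  assumes "C \<in> P" "u \<in> nvertices D" "u \<noteq> hub C"
  shows "set (inners C) \<inter> set (edge_order D u) = {}"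
  using assms inner_endpoint[of C _ u] collection_subset[of C] vertex_kinds_disjoint[of u]
  by (auto simp: set_inners vertices_def subset_iff)

lemma inners_disjoint_leaf:
  assumes "C \<in> P" "u \<in> leaves D"
  shows "set (inners C) \<inter> set (edge_order D u) = {}"
  using assms inner_endpoint[of C _ u] collection_subset[of C] hub[of C] vertex_kinds_disjoint[of u]
  by (auto simp: set_inners vertices_def subset_iff)

lemma inners_disjoint:
  assumes "C \<in> P" "C' \<in> P" "C \<noteq> C'"
  shows "set (inners C) \<inter> set (inners C') = {}"
proof -
  have False if v: "v \<in> C" "v' \<in> C'" "inner C v = inner C' v'" for v v'
  proof -
    have "v' \<in> markings D" using collection_subset[OF assms(2)] v(2) by blast
    then have "v' = v"
      using marking_endpoint[OF assms(1) v(1)] inner_in_marking_order[OF assms(2) v(2)] v(3) by simp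
    then show False using collection_unique[OF assms(1,2) v(1)] v(2) assms(3) by simp
  qed
  then show ?thesis using assms by (auto simp: set_inners)
qed

lemma inners_outers_disjoint: "C \<in> P \<Longrightarrow> set (inners C) \<inter> set (outers C) = {}"
  using inner_neq_outer by (auto simp: set_inners set_outers)

section \<open>Effect of a recoloring on properness and sign\<close>

lemma map_recolored:
  assumes "\<pi> permutes set (inners C)" "set (inners C) \<inter> set xs = {}"
  shows "map (\<kappa> \<circ> \<pi>) xs = map \<kappa> xs"
proof -
  have "\<pi> x = x" if "x \<in> set xs" for x
    using permutes_not_in[OF assms(1), of x] assms(2) that by blast
  then show ?thesis by simp
qed

text \<open>As a permutation of the whole edge set, \<pi> is the identity outside it, so the default
  value there survives.\<close>

lemma recolored_colorings:
  assumes "C \<in> P" "\<pi> permutes set (inners C)" "\<kappa> \<in> colorings n D"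
  shows "\<kappa> \<circ> \<pi> \<in> colorings n D"
proof -
  have "\<pi> permutes edge_set D"
    using assms(2) inners_subset_edge_set[OF assms(1)] by (rule permutes_subset)
  then show ?thesis
    using assms(3) by (auto simp: colorings_def PiE_iff extensional_def permutes_in_image permutes_not_in)
qed

text \<open>At the hub \<pi> only rearranges the edges among themselves; at every other n-vertex the
  colors are unchanged.\<close>

lemma recolored_proper:
  assumes C: "C \<in> P" and \<pi>: "\<pi> permutes set (inners C)" and \<kappa>: "proper D \<kappa>"
  shows "proper D (\<kappa> \<circ> \<pi>)"
  unfolding proper_def
proof
  fix u assume u: "u \<in> nvertices D"
  then have dist: "distinct (map \<kappa> (edge_order D u))" using \<kappa> by (simp add: proper_def)
  show "distinct (map (\<kappa> \<circ> \<pi>) (edge_order D u))"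
  proof (cases "u = hub C")
    case True
    have "\<pi> permutes set (edge_order D u)"
      using \<pi> inners_subset_hub[OF C] True by (auto intro: permutes_subset)
    then have "bij_betw \<pi> (set (edge_order D u)) (set (edge_order D u))"
      by (rule permutes_imp_bij)
    then show ?thesis
      using dist by (auto simp: distinct_map bij_betw_def intro: comp_inj_on)
  next
    case False
    then show ?thesis
      using dist map_recolored[OF \<pi> inners_disjoint_nvertex[OF C u False], of \<kappa>] by (simp only:)
  qed
qed

lemma inj_on_inners: "C \<in> P \<Longrightarrow> proper D \<kappa> \<Longrightarrow> inj_on \<kappa> (set (inners C))"
  using inners_subset_hub hub by (fastforce simp: proper_def distinct_map intro: inj_on_subset)

text \<open>Only the factor at the hub changes. There \<pi> corresponds to a permutation \<rho> of
  positions with the same sign, and the permutation defined by the coloring is composed with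
  \<rho>.\<close>

lemma recolored_sign:
  assumes C: "C \<in> P" and \<pi>: "\<pi> permutes set (inners C)" and \<kappa>: "\<kappa> \<in> colorings n D" "proper D \<kappa>"
  shows "coloring_sign n D (\<kappa> \<circ> \<pi>) = sign \<pi> * coloring_sign n D \<kappa>"
proof -
  let ?w = "hub C"
  let ?\<tau> = "\<lambda>\<kappa> v i. if i < n then \<kappa> (edge_order D v ! i) else i"
  have w: "?w \<in> nvertices D" using C hub by simp
  have len: "length (edge_order D v) = n" if "v \<in> nvertices D" for v
    using length_edge_order[OF D, of v] D that by (simp add: vertices_def trace_diagram_def)
  have other: "sign (?\<tau> (\<kappa> \<circ> \<pi>) v) = sign (?\<tau> \<kappa> v)" if "v \<in> nvertices D - {?w}" for v
  proof -
    have "map (\<kappa> \<circ> \<pi>) (edge_order D v) = map \<kappa> (edge_order D v)"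
      using map_recolored[OF \<pi> inners_disjoint_nvertex[OF C, of v]] that by simp
    then have "?\<tau> (\<kappa> \<circ> \<pi>) v = ?\<tau> \<kappa> v"
      using len[of v] that by (auto simp: fun_eq_iff list_eq_iff_nth_eq)
    then show ?thesis by simp
  qed
  have "sign (?\<tau> (\<kappa> \<circ> \<pi>) ?w) = sign \<pi> * sign (?\<tau> \<kappa> ?w)"
  proof -
    let ?os = "edge_order D ?w"
    have dist: "distinct (map \<kappa> ?os)" using \<kappa> w by (simp add: proper_def)
    then have "distinct ?os" by (simp add: distinct_map)
    then have os: "bij_betw ((!) ?os) {..<n} (set ?os)" using len[OF w] by (intro bij_betw_nth) auto
    have \<pi>': "\<pi> permutes set ?os" using \<pi> inners_subset_hub[OF C] by (rule permutes_subset)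
    then have "bij_betw (\<pi> \<circ> (!) ?os) {..<n} (set ?os)"
      by (intro bij_betw_trans[OF os] permutes_imp_bij)
    from ex_permutes_bij_betw[OF this os]
    obtain \<rho> where \<rho>: "\<rho> permutes {..<n}" "\<And>i. i < n \<Longrightarrow> \<pi> (?os ! i) = ?os ! \<rho> i" by auto
    \<comment> \<open>Since \<pi> is supported on the edges at the hub, it is the transport of
      \<rho> along their ordering, which preserves the sign.\<close>
    have "\<pi> x = map_permutation {..<n} ((!) ?os) \<rho> x" for x
    proof (cases "x \<in> set ?os")
      case True
      then obtain i where "i < n" "x = ?os ! i" using len[OF w] by (metis in_set_conv_nth)
      then show ?thesis using \<rho> os by (simp add: map_permutation_apply bij_betw_def)
    next
      case False
      then show ?thesis
        using \<pi>' map_permutation_permutes[OF os \<rho>(1)] by (simp add: permutes_not_in)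
    qed
    then have "\<pi> = map_permutation {..<n} ((!) ?os) \<rho>" ..
    then have "sign \<pi> = sign \<rho>"
      using sign_map_permutation[OF _ \<rho>(1), of "(!) ?os"] os by (simp add: bij_betw_def)
    moreover have "?\<tau> (\<kappa> \<circ> \<pi>) ?w = ?\<tau> \<kappa> ?w \<circ> \<rho>"
      using \<rho> permutes_in_image[OF \<rho>(1)] by (auto simp: fun_eq_iff permutes_not_in)
    \<comment> \<open>Multiplicativity of \<open>sign\<close> is applied to genuine permutations:
      properness gives injectivity, and finiteness of \<open>{..<n}\<close> then gives
      surjectivity.\<close>
    moreover have "?\<tau> \<kappa> ?w permutes {..<n}"
    proof (rule bij_imp_permutes)
      have "inj_on (?\<tau> \<kappa> ?w) {..<n}"
        using dist len[OF w] by (auto simp: inj_on_def distinct_conv_nth)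
      moreover have "?\<tau> \<kappa> ?w ` {..<n} \<subseteq> {..<n}"
      proof -
        have "?os ! i \<in> edge_set D" if "i < n" for i
          using set_edge_order[OF D, of ?w] len[OF w] w that nth_mem[of i ?os] by (auto simp: vertices_def)
        then show ?thesis using \<kappa>(1) by (auto simp: colorings_def)
      qed
      ultimately show "bij_betw (?\<tau> \<kappa> ?w) {..<n} {..<n}"
        unfolding bij_betw_def by (intro conjI endo_inj_surj) auto
    qed auto
    ultimately show ?thesis
      using \<rho>(1) by (simp add: sign_compose permutes_imp_permutation[of "{..<n}"] mult.commute)
  qed
  then show ?thesis
    unfolding coloring_sign_def prod.remove[OF finite_vertices(3) w]
    using other by (simp add: mult.assoc cong: prod.cong_simp)
qed

section \<open>Matrix entries of a collection and their minors\<close>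

definition block :: "'a mat \<Rightarrow> 'x set \<Rightarrow> ('e \<Rightarrow> nat) \<Rightarrow> 'a::comm_ring_1" where
  "block M C \<kappa> = (\<Prod>v\<in>C. M $$ (\<kappa> (out_edge D v), \<kappa> (in_edge D v)))"

lemma block_recolored:
  assumes "C \<in> P" "C' \<in> P" "C \<noteq> C'" "\<pi> permutes set (inners C)"
  shows "block M C' (\<kappa> \<circ> \<pi>) = block M C' \<kappa>"
  unfolding block_def
proof (intro prod.cong refl)
  fix v assume v: "v \<in> C'"
  then have m: "v \<in> markings D" "v \<notin> C"
    using assms collection_subset collection_unique by blast+
  show "M $$ ((\<kappa> \<circ> \<pi>) (out_edge D v), (\<kappa> \<circ> \<pi>) (in_edge D v)) =
    M $$ (\<kappa> (out_edge D v), \<kappa> (in_edge D v))"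
    using map_recolored[OF assms(4) inners_disjoint_marking[OF assms(1) m], of \<kappa>]
      marking_edges[OF D m(1)] by simp
qed

text \<open>A uniform form for both orientations, with the inner color first: the inner edge is
  outgoing, hence a row index, for markings oriented towards the hub, and a column index
  otherwise.\<close>

lemma block_eq_prod_nth:
  assumes "C \<in> P"
  shows "block M C = (\<lambda>\<kappa>. \<Prod>i<card C. (if towards C then (\<lambda>a b. M $$ (a, b)) else (\<lambda>a b. M $$ (b, a)))
    (\<kappa> (inners C ! i)) (\<kappa> (outers C ! i)))"
proof
  fix \<kappa>
  have "bij_betw ((!) (members C)) {..<card C} C"
    using assms members length_members by (intro bij_betw_nth) auto
  from prod.reindex_bij_betw[OF this, symmetric]
  show "block M C \<kappa> = (\<Prod>i<card C. (if towards C then (\<lambda>a b. M $$ (a, b)) else (\<lambda>a b. M $$ (b, a)))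
    (\<kappa> (inners C ! i)) (\<kappa> (outers C ! i)))"
    using length_members[OF assms]
    by (auto simp: block_def inners_def outers_def inner_def outer_def intro!: prod.cong)
qed

text \<open>The sign and index sets are read off from the colors alone, so they precede the
  quantifier over \<open>M\<close>; this makes the final coefficients independent of the matrix
  entries. The inner colors are distinct by properness, while repeated outer colors are covered by
  \<open>s = 0\<close>.\<close>

lemma antisymmetrized_block:
  assumes C: "C \<in> P" and \<kappa>: "\<kappa> \<in> colorings n D" "proper D \<kappa>"
  shows "\<exists>s I J. I \<subseteq> {..<n} \<and> J \<subseteq> {..<n} \<and> card I = card C \<and> card J = card C \<and>
    (\<forall>M::'a::comm_ring_1 mat. M \<in> carrier_mat n n \<longrightarrow>
       antisymmetrized (inners C) (block M C) \<kappa> = of_int s * det (submatrix M I J))"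
proof -
  let ?k = "card C" and ?is = "map \<kappa> (inners C)" and ?os = "map \<kappa> (outers C)"
  have len: "length (inners C) = ?k" "length (outers C) = ?k"
    using length_members[OF C] by (simp_all add: inners_def outers_def)
  have "set (outers C) \<subseteq> edge_set D"
    using outer_in_marking_order[OF C] collection_subset[OF C] set_edge_order[OF D]
    by (fastforce simp: set_outers[OF C] vertices_def)
  then have sub: "set ?is \<subseteq> {..<n}" "set ?os \<subseteq> {..<n}"
    using \<kappa>(1) inners_subset_edge_set[OF C] by (auto simp: colorings_def)
  have dist: "distinct ?is"
    using distinct_inners[OF C] inj_on_inners[OF C \<kappa>(2)] by (simp add: distinct_map)
  note det = antisymmetrized_eq_det[OF distinct_inners[OF C] len inners_outers_disjoint[OF C]]
  show ?thesis
  proof (cases "towards C")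
    case True
    have "antisymmetrized (inners C) (block M C) \<kappa> = det (mat ?k ?k (\<lambda>(i, j). M $$ (?is ! i, ?os ! j)))"
      for M :: "'a mat"
    proof -
      let ?A = "mat ?k ?k (\<lambda>(i, j). M $$ (?is ! i, ?os ! j))"
      \<comment> \<open>Inner colors are row indices of \<open>M\<close> but column positions in the
        Leibniz determinant, hence the transpose.\<close>
      have "mat ?k ?k (\<lambda>(i, j). M $$ (\<kappa> (inners C ! j), \<kappa> (outers C ! i))) = ?A\<^sup>T"
        using len by (intro eq_matI) auto
      then show ?thesis
        using True det_transpose[of ?A ?k] by (simp add: block_eq_prod_nth[OF C] det[of "\<lambda>a b. M $$ (a, b)"])
    qed
    then show ?thesis using det_index_lists[OF sub(1) _ sub(2), of ?k] dist len by simp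
  next
    case False
    have "antisymmetrized (inners C) (block M C) \<kappa> = det (mat ?k ?k (\<lambda>(i, j). M $$ (?os ! i, ?is ! j)))"
      for M :: "'a mat"
    proof -
      have "mat ?k ?k (\<lambda>(i, j). M $$ (\<kappa> (outers C ! i), \<kappa> (inners C ! j))) =
          mat ?k ?k (\<lambda>(i, j). M $$ (?os ! i, ?is ! j))"
        using len by (intro eq_matI) auto
      then show ?thesis
        using False by (simp add: block_eq_prod_nth[OF C] det[of "\<lambda>a b. M $$ (b, a)"])
    qed
    then show ?thesis using det_index_lists[OF sub(2) _ sub(1), of ?k] dist len by simp
  qed
qed

text \<open>The colors prescribed by \<gamma> sit on edges at leaves, and inner edges meet no
  leaf.\<close>

lemma recolored_extends:
  assumes "C \<in> P" "\<pi> permutes set (inners C)" "extends \<kappa> \<gamma>"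
    and "\<And>e c. (e, c) \<in> \<gamma> \<Longrightarrow> \<exists>v\<in>leaves D. e \<in> set (edge_order D v)"
  shows "extends (\<kappa> \<circ> \<pi>) \<gamma>"
  unfolding extends_def
proof (intro ballI, clarify)
  fix e c assume e: "(e, c) \<in> \<gamma>"
  then have "e \<notin> set (inners C)"
    using assms(4)[OF e] inners_disjoint_leaf[OF assms(1)] by blast
  then show "(\<kappa> \<circ> \<pi>) e = c"
    using assms(2,3) e by (auto simp: permutes_not_in extends_def)
qed

text \<open>The product over markings splits into one \<open>block\<close> per collection, after
  which \<open>sum_prod_antisymmetrized\<close> applies with the coloring sign as \<open>s\<close>.
  Since \<open>M\<close> assigns arbitrary matrices to labels, all relabelings are covered, and each
  collection keeps a single matrix.\<close>

lemma sum_colorings_eq_sum_antisymmetrized: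
  fixes M :: "'l \<Rightarrow> 'a::comm_ring_1 mat"
  assumes "\<And>e c. (e, c) \<in> \<gamma> \<Longrightarrow> \<exists>v\<in>leaves D. e \<in> set (edge_order D v)"
  defines "S \<equiv> {\<kappa> \<in> colorings n D. proper D \<kappa> \<and> extends \<kappa> \<gamma>}"
  shows "(\<Sum>\<kappa>\<in>S. of_int (coloring_sign n D \<kappa>) *
      (\<Prod>v\<in>markings D. M (marking_label D v) $$ (\<kappa> (out_edge D v), \<kappa> (in_edge D v)))) =
    (\<Sum>\<kappa>\<in>{\<kappa>\<in>S. \<forall>C\<in>P. sorted (map \<kappa> (inners C))}. of_int (coloring_sign n D \<kappa>) *
      (\<Prod>C\<in>P. antisymmetrized (inners C) (block (M (lab C)) C) \<kappa>))"
proof -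
  have "(\<Prod>v\<in>markings D. M (marking_label D v) $$ (\<kappa> (out_edge D v), \<kappa> (in_edge D v))) =
      (\<Prod>C\<in>P. block (M (lab C)) C \<kappa>)" for \<kappa>
  proof -
    have P': "markings D = \<Union>P" using P by (simp add: partition_on_def)
    have disj: "\<forall>A\<in>P. \<forall>B\<in>P. A \<noteq> B \<longrightarrow> A \<inter> B = {}" using collection_unique by blast
    have "(\<Prod>v\<in>markings D. M (marking_label D v) $$ (\<kappa> (out_edge D v), \<kappa> (in_edge D v))) =
      (\<Prod>C\<in>P. \<Prod>v\<in>C. M (marking_label D v) $$ (\<kappa> (out_edge D v), \<kappa> (in_edge D v)))"
      unfolding P' using finite_collection disj by (subst prod.Union_disjoint) auto
    also have "\<dots> = (\<Prod>C\<in>P. block (M (lab C)) C \<kappa>)"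
      unfolding block_def by (intro prod.cong refl) (simp add: lab)
    finally show ?thesis .
  qed
  moreover have "(\<Sum>\<kappa>\<in>S. of_int (coloring_sign n D \<kappa>) * (\<Prod>C\<in>P. block (M (lab C)) C \<kappa>)) =
    (\<Sum>\<kappa>\<in>{\<kappa>\<in>S. \<forall>C\<in>P. sorted (map \<kappa> (inners C))}. of_int (coloring_sign n D \<kappa>) *
      (\<Prod>C\<in>P. antisymmetrized (inners C) (block (M (lab C)) C) \<kappa>))"
  proof (rule sum_prod_antisymmetrized)
    fix C \<kappa> \<pi> assume C: "C \<in> P" and \<kappa>: "\<kappa> \<in> S" and \<pi>: "\<pi> permutes set (inners C)"
    have S: "\<kappa> \<in> colorings n D" "proper D \<kappa>" "extends \<kappa> \<gamma>" using \<kappa> by (simp_all add: S_def)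
    have "extends (\<kappa> \<circ> \<pi>) \<gamma>"
      using C \<pi> S(3) by (rule recolored_extends) (rule assms(1))
    then show "\<kappa> \<circ> \<pi> \<in> S"
      unfolding S_def using recolored_colorings[OF C \<pi> S(1)] recolored_proper[OF C \<pi> S(2)]
      by blast
    show "of_int (coloring_sign n D (\<kappa> \<circ> \<pi>)) = of_int (sign \<pi>) * (of_int (coloring_sign n D \<kappa>) :: 'a)"
      unfolding recolored_sign[OF C \<pi> S(1,2)] by (rule of_int_mult)
  next
    fix C \<kappa> assume "C \<in> P" "\<kappa> \<in> S"
    then show "inj_on \<kappa> (set (inners C))" by (intro inj_on_inners) (auto simp: S_def)
  qed (rule finite_P distinct_inners inners_disjoint block_recolored; assumption)+
  ultimately show ?thesis by (simp only:)
qed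

end


section \<open>Expansion in minors\<close>

text \<open>The list \<open>T\<close> is chosen before \<phi>, so one formal expression must serve
  for all matrices. The condition \<open>I \<noteq> {}\<close> excludes empty minors, which equal 1
  and could pad the number of factors.\<close>

theorem theorem7p8:
  fixes scale :: "'a::field \<Rightarrow> 'b::ab_group_add \<Rightarrow> 'b"
    and n :: nat and e :: "nat \<Rightarrow> 'b" and form :: "'b \<Rightarrow> 'b \<Rightarrow> 'a"
    and D :: "('x, 'e, 'b \<Rightarrow> 'b) diagram"
    and ins outs :: "'x list" and \<alpha> \<beta> :: "nat list"
  assumes "n \<ge> 2"
    and "orthonormal_basis scale n e form"
    and "trace_diagram n D"
    and "\<forall>v\<in>markings D. Vector_Spaces.linear scale scale (marking_label D v)"
    and "\<forall>v\<in>markings D. \<exists>w\<in>nvertices D. adjacent D v w"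
    and "framing D ins outs"
    and "\<alpha> \<in> multi_indices n (length ins)"
    and "\<beta> \<in> multi_indices n (length outs)"
  shows "\<exists>T :: ('a \<times> (('b \<Rightarrow> 'b) \<times> nat set \<times> nat set) list) list.
      (\<forall>(c, ms)\<in>set T.
         length ms = compatible_partition_number D \<and>
         (\<forall>(A, I, J)\<in>set ms. A \<in> marking_label D ` markings D \<and>
            I \<subseteq> {..<n} \<and> J \<subseteq> {..<n} \<and> card I = card J \<and> I \<noteq> {})) \<and>
      (\<forall>\<phi> :: ('b \<Rightarrow> 'b) \<Rightarrow> ('b \<Rightarrow> 'b).
         (\<forall>v\<in>markings D. Vector_Spaces.linear scale scale (\<phi> (marking_label D v))) \<longrightarrow>
         orthonormal_basis.trace_diagram_function n e form (relabel \<phi> D) ins outs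
           (orthonormal_basis.basis_tensor n e form \<alpha>) \<beta> =
         (\<Sum>(c, ms)\<leftarrow>T. c *
            (\<Prod>(A, I, J)\<leftarrow>ms. orthonormal_basis.minor n e form (\<phi> A) I J)))"
proof -
  interpret orthonormal_basis scale n e form by fact
  obtain P where P: "partition_on (markings D) P" "\<And>C. C \<in> P \<Longrightarrow> compatible_collection D C"
    and cardP: "card P = compatible_partition_number D"
    using compatible_partition[OF assms(3,5)] by blast
  have "\<exists>w t A vs. w \<in> nvertices D \<and>
      (\<forall>v\<in>C. joins D (if t then out_edge D v else in_edge D v) v w) \<and>
      (\<forall>v\<in>C. marking_label D v = A) \<and> set vs = C \<and> distinct vs" if C: "C \<in> P" for C
  proof -
    have "finite C"
      using P(1) C assms(3) by (auto simp: trace_diagram_def vertices_def partition_on_def intro: finite_subset)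
    then obtain vs where "set vs = C" "distinct vs" using finite_distinct_list by blast
    moreover obtain w where "w \<in> nvertices D" and
      w: "(\<forall>v\<in>C. joins D (out_edge D v) v w) \<or> (\<forall>v\<in>C. joins D (in_edge D v) v w)"
      using P(2)[OF C] unfolding compatible_collection_def by blast
    moreover have "\<exists>t. \<forall>v\<in>C. joins D (if t then out_edge D v else in_edge D v) v w"
      using w by (rule disjE) (rule exI[of _ True], simp, rule exI[of _ False], simp)
    moreover obtain A where "\<forall>v\<in>C. marking_label D v = A"
      using P(2)[OF C] unfolding compatible_collection_def by blast
    ultimately show ?thesis by blast
  qed
  then obtain hub towards lab members where "\<And>C. C \<in> P \<Longrightarrow> hub C \<in> nvertices D \<and>
      (\<forall>v\<in>C. joins D (if towards C then out_edge D v else in_edge D v) v (hub C)) \<and>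
      (\<forall>v\<in>C. marking_label D v = lab C) \<and> set (members C) = C \<and> distinct (members C)"
    by metis
  then interpret oriented_partition n D P hub towards lab members
    using assms(3) P by unfold_locales auto
  define \<gamma> where "\<gamma> = leaf_coloring D ins \<alpha> \<union> leaf_coloring D outs \<beta>"
  define S where "S = {\<kappa> \<in> colorings n D. proper D \<kappa> \<and> extends \<kappa> \<gamma>}"
  define S' where "S' = {\<kappa>\<in>S. \<forall>C\<in>P. sorted (map \<kappa> (inners C))}"
  have \<gamma>: "\<exists>v\<in>leaves D. e \<in> set (edge_order D v)" if "(e, c) \<in> \<gamma>" for e c
    using that assms(6) leaf_edge_in_edge_order[OF assms(3)]
    by (fastforce simp: \<gamma>_def leaf_coloring_def framing_def dest: set_zip_leftD)
  have "finite (colorings n D)" unfolding colorings_def by (intro finite_PiE finite_edge_set) auto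
  then have "finite S'" by (simp add: S'_def S_def)
  then obtain \<kappa>s where \<kappa>s: "set \<kappa>s = S'" "distinct \<kappa>s" using finite_distinct_list by blast
  obtain Ps where Ps: "set Ps = P" "distinct Ps" using finite_distinct_list[OF finite_P] by blast
  have "\<exists>s I J. I \<subseteq> {..<n} \<and> J \<subseteq> {..<n} \<and> card I = card C \<and> card J = card C \<and>
      (\<forall>M::'a mat. M \<in> carrier_mat n n \<longrightarrow>
         antisymmetrized (inners C) (block M C) \<kappa> = of_int s * det (submatrix M I J))"
    if "\<kappa> \<in> S'" "C \<in> P" for \<kappa> C
    using that by (intro antisymmetrized_block) (auto simp: S'_def S_def)
  \<comment> \<open>These choices depend only on the sorted coloring and the collection, not on
    \<phi>.\<close>
  then obtain s I J where sIJ: "\<And>\<kappa> C. \<kappa> \<in> S' \<Longrightarrow> C \<in> P \<Longrightarrow>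
      I \<kappa> C \<subseteq> {..<n} \<and> J \<kappa> C \<subseteq> {..<n} \<and> card (I \<kappa> C) = card C \<and> card (J \<kappa> C) = card C \<and>
      (\<forall>M::'a mat. M \<in> carrier_mat n n \<longrightarrow>
         antisymmetrized (inners C) (block M C) \<kappa> =
           of_int (s \<kappa> C) * det (submatrix M (I \<kappa> C) (J \<kappa> C)))"
    by metis
  \<comment> \<open>One term for each sorted coloring and one minor for each collection. The
    coefficient gathers the coloring sign and the signs, possibly 0, of the determinants.\<close>
  define T where "T = map (\<lambda>\<kappa>. (of_int (coloring_sign n D \<kappa>) * (\<Prod>C\<in>P. of_int (s \<kappa> C)) :: 'a,
    map (\<lambda>C. (lab C, I \<kappa> C, J \<kappa> C)) Ps)) \<kappa>s"
  have "length Ps = compatible_partition_number D"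
    using Ps cardP by (metis distinct_card)
  moreover have "lab C \<in> marking_label D ` markings D" if "C \<in> P" for C
    using that collection_nonempty[OF that] collection_subset[OF that]
      oriented_partition.lab[OF oriented_partition_axioms that] by force
  \<comment> \<open>The classes of a partition are nonempty, so each minor has positive
    size.\<close>
  moreover have "I \<kappa> C \<noteq> {}" if "\<kappa> \<in> S'" "C \<in> P" for \<kappa> C
    using sIJ[OF that] collection_nonempty finite_collection that by (metis card_0_eq card.empty)
  ultimately have "\<forall>(c, ms)\<in>set T. length ms = compatible_partition_number D \<and>
      (\<forall>(A, I, J)\<in>set ms. A \<in> marking_label D ` markings D \<and>
         I \<subseteq> {..<n} \<and> J \<subseteq> {..<n} \<and> card I = card J \<and> I \<noteq> {})"
    using sIJ \<kappa>s Ps by (auto simp: T_def)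
  moreover have "trace_diagram_function (relabel \<phi> D) ins outs (basis_tensor \<alpha>) \<beta> =
      (\<Sum>(c, ms)\<leftarrow>T. c * (\<Prod>(A, I, J)\<leftarrow>ms. minor (\<phi> A) I J))" for \<phi>
  proof -
    have "trace_diagram_function (relabel \<phi> D) ins outs (basis_tensor \<alpha>) \<beta> =
        (\<Sum>\<beta>'\<in>multi_indices n (length outs). weight (relabel \<phi> D)
          (leaf_coloring D ins \<alpha> \<union> leaf_coloring D outs \<beta>') * (if \<beta> = \<beta>' then 1 else 0))"
      unfolding trace_diagram_function_basis_tensor[OF assms(7)]
      by (intro sum.cong refl)
        (simp add: basis_tensor_apply leaf_coloring_def leaf_edge_def[abs_def] relabel_def)
    also have "\<dots> = weight (relabel \<phi> D) \<gamma>"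
      using assms(8) by (simp add: finite_multi_indices \<gamma>_def if_distrib[where f = "(*) _"] cong: if_cong)
    \<comment> \<open>Relabeling affects only the matrices: colorings, properness and signs are
      those of \<open>D\<close>.\<close>
    also have "\<dots> = (\<Sum>\<kappa>\<in>S. of_int (coloring_sign n D \<kappa>) * (\<Prod>v\<in>markings D.
        matrix_of (\<phi> (marking_label D v)) $$ (\<kappa> (out_edge D v), \<kappa> (in_edge D v))))"
      by (simp add: weight_def marking_product_def S_def relabel_def colorings_def proper_def
          coloring_sign_def out_edge_def in_edge_def cong: if_cong)
    also have "\<dots> = (\<Sum>\<kappa>\<in>S'. of_int (coloring_sign n D \<kappa>) *
        (\<Prod>C\<in>P. antisymmetrized (inners C) (block (matrix_of (\<phi> (lab C))) C) \<kappa>))"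
      unfolding S_def S'_def by (rule sum_colorings_eq_sum_antisymmetrized) (rule \<gamma>)
    also have "\<dots> = (\<Sum>\<kappa>\<in>S'. of_int (coloring_sign n D \<kappa>) *
        (\<Prod>C\<in>P. of_int (s \<kappa> C) * minor (\<phi> (lab C)) (I \<kappa> C) (J \<kappa> C)))"
      using sIJ by (intro sum.cong refl arg_cong2[where f = "(*)"] prod.cong)
        (auto simp: minor_def matrix_of_def)
    also have "\<dots> = (\<Sum>(c, ms)\<leftarrow>T. c * (\<Prod>(A, I, J)\<leftarrow>ms. minor (\<phi> A) I J))"
      using \<kappa>s Ps
      by (simp add: T_def comp_def sum_list_distinct_conv_sum_set prod.distinct_set_conv_list[symmetric]
          prod.distrib mult.assoc)
    finally show ?thesis .
  qed
  ultimately show ?thesis by blast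
qed

end
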